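(* Let $k$ be an integer and let $p$ and $p'$ be two partitions in $\mathcal{P}_k$. Then $$d(\mathrm{id}_k,p\circ p')\leq d(\mathrm{id}_k,p)+d(\mathrm{id}_k,p')-\frac{k+\mathrm{nc}(p\circ p')-\mathrm{nc}(p)-\mathrm{nc}(p')}{2}-\kappa(p,p').$$
   Context: $\mathcal{P}_k$ is the set of partitions of $\{1,\dots,k\}\cup\{1',\dots,k'\}$ ($2k$ elements; $1,\dots,k$ form the top row, $1',\dots,k'$ the bottom row), and $\mathrm{id}_k=\{\{i,i'\}: i=1,\dots,k\}$. $\mathrm{nc}(p)$ is the number of blocks of $p$, $p\vee p'$ is the finest partition coarser than $p$ and $p'$, and $d(p,p')=\frac12(\mathrm{nc}(p)+\mathrm{nc}(p'))-\mathrm{nc}(p\vee p')$. Composition: to form $p\circ p'$, put a diagram of $p'$ above a diagram of $p$ and identify the bottom vertex $i'$ of $p'$ with the top vertex $i$ of $p$ for each $i$. One obtains a graph on three rows of $k$ vertices (top, middle, bottom). The partition $p\circ p'\in\mathcal{P}_k$ is the partition of the top and bottom rows (labelled $1,\dots,k$ and $1',\dots,k'$) induced by the connected components of this graph, and $\kappa(p,p')$ is the number of connected components entirely contained in the middle row. *)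

theory Defs
  imports Complex_Main "HOL-Library.Disjoint_Sets"
begin

section \<open>Partitions of two rows of k points\<close>

text \<open>\<open>Top i\<close> is the element i of the top row, \<open>Bot i\<close> is the element i' of the bottom row.\<close>

datatype point = Top nat | Bot nat

definition points :: "nat \<Rightarrow> point set" where
  "points k = Top ` {1..k} \<union> Bot ` {1..k}"

definition Partitions :: "nat \<Rightarrow> point set set set" where
  "Partitions k = {p. partition_on (points k) p}"

definition id_part :: "nat \<Rightarrow> point set set" where
  "id_part k = (\<lambda>i. {Top i, Bot i}) ` {1..k}"

definition nc :: "'a set set \<Rightarrow> nat" where
  "nc p = card p"

text \<open>In \<open>refines A P Q\<close>, \<open>Q\<close> is the coarser partition.\<close>

definition is_join :: "'a set \<Rightarrow> 'a set set \<Rightarrow> 'a set set \<Rightarrow> 'a set set \<Rightarrow> bool" where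
  "is_join A P Q R \<longleftrightarrow> refines A P R \<and> refines A Q R \<and>
     (\<forall>S. refines A P S \<and> refines A Q S \<longrightarrow> refines A R S)"

definition join :: "'a set \<Rightarrow> 'a set set \<Rightarrow> 'a set set \<Rightarrow> 'a set set" where
  "join A P Q = (THE R. is_join A P Q R)"

definition dist_part :: "nat \<Rightarrow> point set set \<Rightarrow> point set set \<Rightarrow> real" where
  "dist_part k p p' = (real (nc p) + real (nc p')) / 2 - real (nc (join (points k) p p'))"


section \<open>Composition\<close>

text \<open>The vertices of the stacked diagrams: an upper, a middle and a lower row.\<close>

datatype vertex = Upper nat | Middle nat | Lower nat

definition vertices :: "nat \<Rightarrow> vertex set" where
  "vertices k = Upper ` {1..k} \<union> Middle ` {1..k} \<union> Lower ` {1..k}"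

primrec place_above :: "point \<Rightarrow> vertex" where
  "place_above (Top i) = Upper i"
| "place_above (Bot i) = Middle i"

primrec place_below :: "point \<Rightarrow> vertex" where
  "place_below (Top i) = Middle i"
| "place_below (Bot i) = Lower i"

primrec place_outer :: "point \<Rightarrow> vertex" where
  "place_outer (Top i) = Upper i"
| "place_outer (Bot i) = Lower i"

text \<open>
  As diagram of a partition we take the graph in which any two points of the same block are
  adjacent. Any other graph whose connected components are the blocks has the same reachability
  relation, so that this choice does not affect the connected components of the stacked diagrams.
\<close>

definition diagram :: "point set set \<Rightarrow> (point \<times> point) set" where
  "diagram p = {(x, y). \<exists>B\<in>p. x \<in> B \<and> y \<in> B}"

text \<open>The second argument is the partition placed above, as in the composition of maps.\<close>

definition stacked :: "point set set \<Rightarrow> point set set \<Rightarrow> (vertex \<times> vertex) set" where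
  "stacked p p' = map_prod place_above place_above ` diagram p' \<union>
                  map_prod place_below place_below ` diagram p"

definition components :: "'a set \<Rightarrow> ('a \<times> 'a) set \<Rightarrow> 'a set set" where
  "components V E = V // {(u, v) \<in> V \<times> V. (u, v) \<in> (E \<union> E\<inverse>)\<^sup>*}"

definition comp_part :: "nat \<Rightarrow> point set set \<Rightarrow> point set set \<Rightarrow> point set set" where
  "comp_part k p p' = (\<lambda>C. place_outer -` C) ` components (vertices k) (stacked p p') - {{}}"

definition kappa :: "nat \<Rightarrow> point set set \<Rightarrow> point set set \<Rightarrow> nat" where
  "kappa k p p' = card {C \<in> components (vertices k) (stacked p p'). C \<subseteq> Middle ` {1..k}}"


section \<open>Well-definedness\<close>

lemma id_part_in_Partitions: "id_part k \<in> Partitions k"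
  unfolding Partitions_def mem_Collect_eq
  by (rule partition_onI) (auto simp: id_part_def points_def disjnt_def)

lemma is_join_unique:
  assumes "is_join A P Q R" "is_join A P Q R'"
  shows "R = R'"
  using assms unfolding is_join_def by (meson refines_asym)

lemma is_join_ex:
  assumes P: "partition_on A P" and Q: "partition_on A Q"
  shows "\<exists>R. is_join A P Q R"
proof -
  define r where "r = {(x, y). \<exists>B\<in>P \<union> Q. x \<in> B \<and> y \<in> B}"
  define s where "s = {(x, y) \<in> A \<times> A. (x, y) \<in> r\<^sup>*}"
  have symr: "sym (r\<^sup>*)"
    by (intro sym_rtrancl) (auto simp: r_def sym_def)
  have eq: "equiv A s"
    using symr unfolding s_def
    by (intro equivI) (auto simp: refl_on_def sym_def intro: transI)
  have part: "partition_on A (A // s)"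
    using eq by (rule partition_on_quotient)
  have ref: "refines A X (A // s)" if X: "X = P \<or> X = Q" for X
  proof -
    have XA: "partition_on A X" using X P Q by auto
    have "\<exists>C\<in>A // s. B \<subseteq> C" if B: "B \<in> X" for B
    proof -
      have "B \<noteq> {}" "B \<subseteq> A" using XA B by (auto simp: partition_on_def)
      then obtain x where x: "x \<in> B" "x \<in> A" by auto
      have "B \<subseteq> s `` {x}"
        using x B X \<open>B \<subseteq> A\<close> by (auto simp: s_def r_def intro!: r_into_rtrancl)
      then show ?thesis using x by (auto simp: quotient_def)
    qed
    then show ?thesis using XA part by (auto simp: refines_def)
  qed
  have least: "refines A (A // s) S" if PS: "refines A P S" and QS: "refines A Q S" for S
  proof -
    have S: "partition_on A S" using PS by (simp add: refines_def)
    have r_closed: "y \<in> C" if "(x, y) \<in> r" "x \<in> C" "C \<in> S" for x y C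
    proof -
      obtain B where B: "B \<in> P \<or> B \<in> Q" "x \<in> B" "y \<in> B"
        using \<open>(x, y) \<in> r\<close> unfolding r_def by blast
      obtain D where D: "D \<in> S" "B \<subseteq> D"
        using B(1) PS QS unfolding refines_def by metis
      have "disjoint S" using S by (rule partition_onD2)
      moreover have "x \<in> C \<inter> D" using that(2) B D by auto
      ultimately have "C = D" using that(3) D(1) by (auto dest: disjointD)
      with B D show ?thesis by auto
    qed
    have closed: "y \<in> C" if "(x, y) \<in> r\<^sup>*" "x \<in> C" "C \<in> S" for x y C
      using that(1)
    proof (induction rule: rtrancl_induct)
      case base
      show ?case by (rule that(2))
    next
      case (step y z)
      show ?case by (rule r_closed[OF step.hyps(2) step.IH that(3)])
    qed
    have "\<exists>C\<in>S. s `` {x} \<subseteq> C" if "x \<in> A" for x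
    proof -
      obtain C where C: "x \<in> C" "C \<in> S"
        using \<open>x \<in> A\<close> partition_onD1[OF S] by blast
      have "s `` {x} \<subseteq> C" using closed[OF _ C] by (auto simp: s_def)
      with C(2) show ?thesis by blast
    qed
    then show ?thesis using part S by (auto simp: refines_def quotient_def)
  qed
  show ?thesis using ref least unfolding is_join_def by blast
qed

lemma join_is_join:
  assumes "partition_on A P" "partition_on A Q"
  shows "is_join A P Q (join A P Q)"
  unfolding join_def using is_join_ex[OF assms] is_join_unique by (metis theI)

lemma partition_on_components: "partition_on V (components V E)"
proof -
  have "sym ((E \<union> E\<inverse>)\<^sup>*)"
    by (intro sym_rtrancl) (auto simp: sym_def)
  then show ?thesis
    unfolding components_def
    by (intro partition_on_quotient equivI) (auto simp: refl_on_def sym_def intro: transI)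
qed

lemma comp_part_in_Partitions: "comp_part k p p' \<in> Partitions k"
proof -
  have "x \<in> place_outer -` vertices k \<longleftrightarrow> x \<in> points k" for x
    by (cases x) (auto simp: vertices_def points_def)
  then have outer: "place_outer -` vertices k = points k"
    by blast
  define K where "K = components (vertices k) (stacked p p')"
  have K: "\<Union>K = vertices k" "\<And>C D. C \<in> K \<Longrightarrow> D \<in> K \<Longrightarrow> C \<noteq> D \<Longrightarrow> C \<inter> D = {}"
    using partition_on_components[of "vertices k" "stacked p p'"]
    unfolding K_def partition_on_def disjoint_def by auto
  show ?thesis
    unfolding Partitions_def comp_part_def K_def[symmetric] mem_Collect_eq
  proof (rule partition_onI)
    show "\<Union>((\<lambda>C. place_outer -` C) ` K - {{}}) = points k"
      unfolding outer[symmetric] K(1)[symmetric] by blast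
  next
    fix X Y
    assume "X \<in> (\<lambda>C. place_outer -` C) ` K - {{}}" "Y \<in> (\<lambda>C. place_outer -` C) ` K - {{}}" "X \<noteq> Y"
    then show "disjnt X Y"
      using K(2) unfolding disjnt_def by blast
  qed auto
qed

end

theory Submission
  imports Defs
begin

text \<open>
  After clearing denominators the claim reads
  \<open>nc (p \<circ> p') + \<kappa> + nc (id \<or> p) + nc (id \<or> p') \<le> nc p + nc p' + nc (id \<or> (p \<circ> p'))\<close>.
  The sum \<open>nc (p \<circ> p') + \<kappa>\<close> is the number of components of the stacked diagram. The number of
  components lost by adding a set of edges to a graph can only decrease when the graph grows
  (submodularity of the graphic rank), so adding to the stacked diagram all edges
  upper--middle and middle--lower costs at most
  \<open>(nc p' - nc (id \<or> p')) + (nc p - nc (id \<or> p))\<close> components. In the resulting graph every middle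
  vertex is joined to the outer rows and \<open>i\<close> is joined to \<open>i'\<close>, so it has at most
  \<open>nc (id \<or> (p \<circ> p'))\<close> components.
\<close>

section \<open>Connectivity by undirected paths\<close>

text \<open>This is the closure occurring inside \<open>components\<close>, stripped of the vertex
  set, so that graphs on different vertex sets can be compared by mapping paths.\<close>

definition conn :: "('a \<times> 'a) set \<Rightarrow> ('a \<times> 'a) set" where
  "conn E = (E \<union> E\<inverse>)\<^sup>*"

lemma conn_refl: "(x, x) \<in> conn E"
  by (simp add: conn_def)

lemma conn_sym: "(x, y) \<in> conn E \<Longrightarrow> (y, x) \<in> conn E"
  unfolding conn_def by (rule symD[OF sym_rtrancl]) (auto simp: sym_def)

lemma conn_trans: "(x, y) \<in> conn E \<Longrightarrow> (y, z) \<in> conn E \<Longrightarrow> (x, z) \<in> conn E"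
  unfolding conn_def by (rule rtrancl_trans)

lemma conn_edge: "(x, y) \<in> E \<Longrightarrow> (x, y) \<in> conn E"
  by (auto simp: conn_def)

lemma conn_mono: "E \<subseteq> F \<Longrightarrow> conn E \<subseteq> conn F"
  unfolding conn_def by (rule rtrancl_mono) auto

text \<open>Images of edges need only be connected in \<open>G\<close>: later an edge from
  \<open>Top i\<close> to \<open>Bot i\<close> goes to a path through
  \<open>Middle i\<close>.\<close>

lemma conn_map:
  assumes E: "map_prod f f ` E \<subseteq> conn G" and xy: "(x, y) \<in> conn E"
  shows "(f x, f y) \<in> conn G"
  using xy unfolding conn_def[of E]
proof (induction rule: rtrancl_induct)
  case base
  show ?case by (rule conn_refl)
next
  case (step y z)
  have "(f y, f z) \<in> conn G"
    using step.hyps(2)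
  proof
    assume "(y, z) \<in> E"
    then show ?thesis using E by force
  next
    assume "(y, z) \<in> E\<inverse>"
    then have "(f z, f y) \<in> conn G" using E by force
    then show ?thesis by (rule conn_sym)
  qed
  with step.IH show ?case by (rule conn_trans)
qed

text \<open>A path can be shortened until it uses the new edge at most once, in one of its two
  directions. Symmetrising inserts both directions, so \<open>rtrancl_insert\<close> applies twice,
  and transitivity removes the cases using both.\<close>

lemma conn_insert:
  "(u, v) \<in> conn (insert (x, y) E) \<longleftrightarrow>
     (u, v) \<in> conn E \<or> (u, x) \<in> conn E \<and> (y, v) \<in> conn E \<or> (u, y) \<in> conn E \<and> (x, v) \<in> conn E"
proof -
  have "insert (x, y) E \<union> (insert (x, y) E)\<inverse> = insert (x, y) (insert (y, x) (E \<union> E\<inverse>))"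
    by auto
  then show ?thesis
    unfolding conn_def[of "insert _ _"]
    by (auto simp: rtrancl_insert conn_def[symmetric] intro: conn_trans)
qed

section \<open>Components and the effect of one new edge\<close>

definition conn_class :: "'a set \<Rightarrow> ('a \<times> 'a) set \<Rightarrow> 'a \<Rightarrow> 'a set" where
  "conn_class V E u = {v \<in> V. (u, v) \<in> conn E}"

lemma components_eq: "components V E = conn_class V E ` V"
  by (auto simp: components_def quotient_def conn_class_def conn_def)

lemma conn_class_eq_iff:
  assumes "u \<in> V" "v \<in> V"
  shows "conn_class V E u = conn_class V E v \<longleftrightarrow> (u, v) \<in> conn E"
  using assms by (auto simp: conn_class_def intro: conn_refl conn_sym conn_trans)

lemma finite_components: "finite V \<Longrightarrow> finite (components V E)"
  by (simp add: components_eq)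

lemma components_insert_same:
  assumes "(x, y) \<in> conn E"
  shows "components V (insert (x, y) E) = components V E"
proof -
  have "(u, v) \<in> conn (insert (x, y) E) \<longleftrightarrow> (u, v) \<in> conn E" for u v
    using assms unfolding conn_insert by (meson conn_sym conn_trans)
  then show ?thesis by (simp add: components_eq conn_class_def)
qed

text \<open>The classes of \<open>x\<close> and \<open>y\<close> merge and all others stay as they
  are: two components are removed and one is added.\<close>

lemma card_components_insert:
  assumes V: "finite V" "x \<in> V" "y \<in> V" and xy: "(x, y) \<notin> conn E"
  shows "card (components V E) = Suc (card (components V (insert (x, y) E)))"
proof -
  let ?X = "conn_class V E x" and ?Y = "conn_class V E y"
  let ?R = "components V E - {?X, ?Y}"
  have cls: "conn_class V (insert (x, y) E) u =
      (if (u, x) \<in> conn E \<or> (u, y) \<in> conn E then ?X \<union> ?Y else conn_class V E u)" for u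
  proof -
    have "(u, v) \<in> conn (insert (x, y) E) \<longleftrightarrow>
        (if (u, x) \<in> conn E \<or> (u, y) \<in> conn E then (x, v) \<in> conn E \<or> (y, v) \<in> conn E
         else (u, v) \<in> conn E)" for v
      unfolding conn_insert
      by (cases "(u, x) \<in> conn E"; cases "(u, y) \<in> conn E"; simp) (meson conn_sym conn_trans)+
    then show ?thesis by (auto simp: conn_class_def)
  qed
  have cases: "conn_class V E u \<in> {?X, ?Y} \<longleftrightarrow> (u, x) \<in> conn E \<or> (u, y) \<in> conn E" if "u \<in> V" for u
    using that V by (simp add: conn_class_eq_iff)
  have "components V (insert (x, y) E) = insert (?X \<union> ?Y) ?R"
  proof (intro set_eqI iffI)
    fix C assume "C \<in> components V (insert (x, y) E)"
    then show "C \<in> insert (?X \<union> ?Y) ?R"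
      using cases by (auto simp: components_eq cls)
  next
    fix C assume "C \<in> insert (?X \<union> ?Y) ?R"
    then consider "C = ?X \<union> ?Y" | "C \<in> ?R" by blast
    then show "C \<in> components V (insert (x, y) E)"
    proof cases
      case 1
      then have "C = conn_class V (insert (x, y) E) x" by (simp add: cls conn_refl)
      then show ?thesis using V by (simp add: components_eq)
    next
      case 2
      then obtain u where u: "u \<in> V" "C = conn_class V E u" "conn_class V E u \<notin> {?X, ?Y}"
        by (auto simp: components_eq)
      then have "C = conn_class V (insert (x, y) E) u" using cases[OF u(1)] by (simp add: cls)
      then show ?thesis using u by (simp add: components_eq)
    qed
  qed
  \<comment> \<open>The merged class must be new, so that inserting it raises the cardinality of
    \<open>?R\<close> by one.\<close>
  moreover have "?X \<union> ?Y \<notin> components V E"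
  proof
    assume "?X \<union> ?Y \<in> components V E"
    then obtain u where "?X \<union> ?Y = conn_class V E u" by (auto simp: components_eq)
    moreover have "x \<in> ?X" "y \<in> ?Y" using V by (auto simp: conn_class_def conn_refl)
    ultimately have "(u, x) \<in> conn E" "(u, y) \<in> conn E" by (auto simp: conn_class_def)
    then show False using xy by (blast intro: conn_sym conn_trans)
  qed
  moreover have "card {?X, ?Y} = 2"
    using V xy by (simp add: conn_class_eq_iff)
  moreover have sub: "{?X, ?Y} \<subseteq> components V E"
    using V by (simp add: components_eq)
  \<comment> \<open>Guards the truncated subtraction in the cardinality of
    \<open>?R\<close>.\<close>
  moreover have "card {?X, ?Y} \<le> card (components V E)"
    using sub V by (intro card_mono finite_components)
  ultimately show ?thesis
    using V by (simp add: card_Diff_subset finite_components)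
qed

section \<open>Comparing component counts along a vertex map\<close>

text \<open>Adding \<open>F\<close> to \<open>E\<close> destroys at least as many components as
  adding its image to the larger graph \<open>G\<close>. Edges are added one at a time, and each
  costs either one component or none. The sums on both sides avoid subtraction of naturals.\<close>

lemma components_submodular:
  assumes A: "finite A" and V: "finite V" and f: "f ` A \<subseteq> V"
    and F: "finite F" "F \<subseteq> A \<times> A" and EG: "map_prod f f ` E \<subseteq> G"
  shows "card (components V G) + card (components A (E \<union> F))
    \<le> card (components A E) + card (components V (G \<union> map_prod f f ` F))"
  using F
proof (induction F)
  case empty
  show ?case by simp
next
  case (insert e F)
  obtain x y where e: "e = (x, y)" by (cases e)
  let ?E = "E \<union> F" and ?G = "G \<union> map_prod f f ` F"
  have xy: "x \<in> A" "y \<in> A" using insert.prems e by auto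
  have fxy: "f x \<in> V" "f y \<in> V" using xy f by auto
  have IH: "card (components V G) + card (components A ?E)
      \<le> card (components A E) + card (components V ?G)"
    using insert by auto
  have eqs: "E \<union> insert e F = insert (x, y) ?E"
    "G \<union> map_prod f f ` insert e F = insert (f x, f y) ?G"
    by (auto simp: e)
  have down: "card (components A (insert (x, y) ?E)) \<le> card (components A ?E)"
    using card_components_insert[OF A xy, of ?E] components_insert_same[of x y ?E A]
    by (cases "(x, y) \<in> conn ?E") auto
  show ?case
  proof (cases "(f x, f y) \<in> conn ?G")
    case True
    then show ?thesis using IH down by (simp only: eqs components_insert_same)
  next
    case False
    \<comment> \<open>By contraposition of \<open>conn_map\<close>, an edge that merges components
      in \<open>?G\<close> also merges components in \<open>?E\<close>, so both counts drop by
      one.\<close>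
    have "map_prod f f ` ?E \<subseteq> conn ?G" using EG by (auto intro!: conn_edge)
    then have "(x, y) \<notin> conn ?E" using False conn_map by metis
    then show ?thesis
      using IH card_components_insert[OF A xy, of ?E] card_components_insert[OF V fxy False]
      unfolding eqs by linarith
  qed
qed

lemma card_components_le:
  assumes A: "finite A" and f: "f ` A \<subseteq> V" and E: "map_prod f f ` E \<subseteq> conn G"
    and hit: "\<And>v. v \<in> V \<Longrightarrow> \<exists>a\<in>A. (f a, v) \<in> conn G"
  shows "card (components V G) \<le> card (components A E)"
proof (rule surj_card_le)
  \<comment> \<open>Sends a component of \<open>E\<close> to the component of \<open>G\<close>
    containing its image. It is well defined because \<open>f\<close> preserves connectivity, and
    onto because of \<open>hit\<close>.\<close>
  let ?g = "\<lambda>C. {v \<in> V. \<exists>a\<in>C. (f a, v) \<in> conn G}"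
  show "finite (components A E)" using A by (rule finite_components)
  show "components V G \<subseteq> ?g ` components A E"
  proof
    fix C assume "C \<in> components V G"
    then obtain v where v: "v \<in> V" "C = conn_class V G v" by (auto simp: components_eq)
    obtain a where a: "a \<in> A" "(f a, v) \<in> conn G" using hit v by blast
    have "C = ?g (conn_class A E a)"
    proof (intro set_eqI iffI)
      fix w assume "w \<in> C"
      then have "w \<in> V" "(f a, w) \<in> conn G"
        using v a by (auto simp: conn_class_def intro: conn_trans)
      moreover have "a \<in> conn_class A E a" using a by (simp add: conn_class_def conn_refl)
      ultimately show "w \<in> ?g (conn_class A E a)" by blast
    next
      fix w assume "w \<in> ?g (conn_class A E a)"
      then obtain b where b: "w \<in> V" "(a, b) \<in> conn E" "(f b, w) \<in> conn G"
        by (auto simp: conn_class_def)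
      then have "(f a, w) \<in> conn G" using conn_map[OF E] conn_trans by metis
      then have "(v, w) \<in> conn G" using a(2) conn_sym conn_trans by metis
      then show "w \<in> C" using b v by (simp add: conn_class_def)
    qed
    then show "C \<in> ?g ` components A E" using a(1) by (auto simp: components_eq)
  qed
qed

section \<open>Joins of partitions as graph components\<close>

lemma conn_in_partition_block:
  assumes S: "partition_on A S" and E: "\<And>u v. (u, v) \<in> E \<Longrightarrow> \<exists>C\<in>S. u \<in> C \<and> v \<in> C"
    and xy: "(x, y) \<in> conn E" and C: "x \<in> C" "C \<in> S"
  shows "y \<in> C"
  using xy unfolding conn_def
proof (induction rule: rtrancl_induct)
  case base
  show ?case by (rule C(1))
next
  case (step y z)
  obtain D where D: "D \<in> S" "y \<in> D" "z \<in> D" using step.hyps(2) E by blast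
  have "C = D"
    using partition_onD2[OF S] C(2) D(1,2) step.IH by (auto dest: disjointD)
  with D show ?case by simp
qed

text \<open>Blocks are cliques of the diagrams, which gives the upper bound. It is least because no
  path can leave a block of a partition coarser than both. Thus block counts of joins become
  component counts.\<close>

lemma is_join_components:
  assumes P: "partition_on A P" and Q: "partition_on A Q"
  shows "is_join A P Q (components A (diagram P \<union> diagram Q))"
proof -
  let ?E = "diagram P \<union> diagram Q"
  have ref: "refines A X (components A ?E)" if X: "X = P \<or> X = Q" for X
  proof -
    have XA: "partition_on A X" using X P Q by auto
    have "\<exists>C\<in>components A ?E. B \<subseteq> C" if B: "B \<in> X" for B
    proof -
      have "B \<noteq> {}" "B \<subseteq> A" using XA B by (auto simp: partition_on_def)
      then obtain x where x: "x \<in> B" "x \<in> A" by auto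
      have "B \<subseteq> conn_class A ?E x"
        using x B X \<open>B \<subseteq> A\<close> by (auto simp: conn_class_def diagram_def intro!: conn_edge)
      then show ?thesis using x by (auto simp: components_eq)
    qed
    then show ?thesis using XA partition_on_components by (auto simp: refines_def)
  qed
  moreover have "refines A (components A ?E) S" if PS: "refines A P S" and QS: "refines A Q S" for S
  proof -
    have S: "partition_on A S" using PS by (simp add: refines_def)
    have E: "\<exists>C\<in>S. u \<in> C \<and> v \<in> C" if uv: "(u, v) \<in> ?E" for u v
    proof -
      obtain B where "B \<in> P \<or> B \<in> Q" "u \<in> B" "v \<in> B"
        using uv by (auto simp: diagram_def)
      then show ?thesis using PS QS unfolding refines_def by (meson subsetD)
    qed
    have "\<exists>C\<in>S. conn_class A ?E x \<subseteq> C" if "x \<in> A" for x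
    proof -
      obtain C where C: "x \<in> C" "C \<in> S"
        using \<open>x \<in> A\<close> partition_onD1[OF S] by blast
      have "conn_class A ?E x \<subseteq> C"
        using conn_in_partition_block[OF S, of ?E x _ C] E C by (auto simp: conn_class_def)
      with C(2) show ?thesis by blast
    qed
    then show ?thesis
      using S partition_on_components by (auto simp: refines_def components_eq)
  qed
  ultimately show ?thesis unfolding is_join_def by blast
qed

lemma join_eq_components:
  assumes "partition_on A P" "partition_on A Q"
  shows "join A P Q = components A (diagram P \<union> diagram Q)"
  using is_join_unique[OF join_is_join[OF assms] is_join_components[OF assms]] .

text \<open>This is the previous description applied to \<open>P\<close> joined with itself.\<close>

lemma components_diagram:
  assumes "partition_on A P"
  shows "components A (diagram P) = P"
proof -
  have "is_join A P P P" using assms by (simp add: is_join_def refines_refl)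
  then show ?thesis
    using is_join_unique is_join_components[OF assms assms] by fastforce
qed

lemma diagram_subset: "partition_on A P \<Longrightarrow> diagram P \<subseteq> A \<times> A"
  by (auto simp: diagram_def partition_on_def)

section \<open>Components of the stacked diagram\<close>

lemma finite_points: "finite (points k)"
  by (simp add: points_def)

lemma finite_vertices: "finite (vertices k)"
  by (simp add: vertices_def)

text \<open>Components with empty outer trace are exactly those counted by \<open>kappa\<close>. The
  others have distinct traces, since components sharing an outer vertex coincide.\<close>

lemma card_components_stacked:
  "card (components (vertices k) (stacked p p')) = nc (comp_part k p p') + kappa k p p'"
proof -
  define K where "K = components (vertices k) (stacked p p')"
  let ?M = "{C \<in> K. C \<subseteq> Middle ` {1..k}}"
  let ?g = "\<lambda>C. place_outer -` C"
  have K: "partition_on (vertices k) K" unfolding K_def by (rule partition_on_components)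
  have fin: "finite K" unfolding K_def by (intro finite_components finite_vertices)
  have empty: "?g C = {} \<longleftrightarrow> C \<subseteq> Middle ` {1..k}" if "C \<in> K" for C
  proof
    assume C: "?g C = {}"
    show "C \<subseteq> Middle ` {1..k}"
    proof
      fix v assume v: "v \<in> C"
      then have "v \<in> vertices k" using K that by (auto simp: partition_on_def)
      moreover have "v \<noteq> place_outer x" for x using C v by auto
      from this[of "Top _"] this[of "Bot _"] have "v \<noteq> Upper i" "v \<noteq> Lower i" for i by auto
      ultimately show "v \<in> Middle ` {1..k}" by (auto simp: vertices_def)
    qed
  next
    assume C: "C \<subseteq> Middle ` {1..k}"
    have "place_outer x \<notin> C" for x using C by (cases x) auto
    then show "?g C = {}" by auto
  qed
  have "comp_part k p p' = ?g ` (K - ?M)"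
    unfolding comp_part_def K_def[symmetric] using empty by auto
  moreover have "inj_on ?g (K - ?M)"
  proof (rule inj_onI)
    fix C D assume CD: "C \<in> K - ?M" "D \<in> K - ?M" "?g C = ?g D"
    then have "?g C \<noteq> {}" using empty by blast
    then have "C \<inter> D \<noteq> {}" using CD(3) by blast
    then show "C = D" using partition_onD2[OF K] CD by (auto dest: disjointD)
  qed
  ultimately have "nc (comp_part k p p') = card (K - ?M)"
    by (simp add: nc_def card_image)
  moreover have "kappa k p p' = card ?M" by (simp add: kappa_def K_def)
  moreover have "card (K - ?M) + card ?M = card K"
    using fin by (metis (no_types, lifting) Collect_subset add.commute card_Diff_subset card_mono
        finite_subset le_add_diff_inverse mem_Collect_eq subsetI)
  ultimately show ?thesis by (simp add: K_def)
qed

lemma card_components_closure_le: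
  fixes k :: nat and p p' :: "point set set"
  defines "F \<equiv> diagram (id_part k)"
  shows "card (components (vertices k)
      (stacked p p' \<union> map_prod place_below place_below ` F \<union> map_prod place_above place_above ` F))
    \<le> card (components (points k) (F \<union> diagram (comp_part k p p')))"
proof (rule card_components_le[OF finite_points])
  let ?G = "stacked p p' \<union> map_prod place_below place_below ` F \<union> map_prod place_above place_above ` F"
  show "place_outer ` points k \<subseteq> vertices k"
    by (auto simp: points_def vertices_def)
  have edge: "(Top i, Bot i) \<in> F" if "i \<in> {1..k}" for i
    using that by (auto simp: F_def diagram_def id_part_def)
  have up_mid: "(Upper i, Middle i) \<in> conn ?G" if "i \<in> {1..k}" for i
    using edge[OF that] by (intro conn_edge) force
  have mid_low: "(Middle i, Lower i) \<in> conn ?G" if "i \<in> {1..k}" for i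
    using edge[OF that] by (intro conn_edge) force
  have up_low: "(Upper i, Lower i) \<in> conn ?G" if "i \<in> {1..k}" for i
    using up_mid[OF that] mid_low[OF that] by (rule conn_trans)
  \<comment> \<open>A pair in \<open>F\<close> is a loop or joins \<open>Top i\<close> and
    \<open>Bot i\<close> in some order.\<close>
  have "(place_outer x, place_outer y) \<in> conn ?G" if "(x, y) \<in> F" for x y
    using that up_low by (auto simp: F_def diagram_def id_part_def conn_refl intro: conn_sym)
  moreover have "(place_outer x, place_outer y) \<in> conn ?G"
    if "(x, y) \<in> diagram (comp_part k p p')" for x y
  proof -
    obtain C where C: "C \<in> components (vertices k) (stacked p p')"
        "place_outer x \<in> C" "place_outer y \<in> C"
      using \<open>(x, y) \<in> _\<close> by (auto simp: diagram_def comp_part_def)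
    then have "(place_outer x, place_outer y) \<in> conn (stacked p p')"
      by (auto simp: components_eq conn_class_def intro: conn_sym conn_trans)
    then show ?thesis using conn_mono[of "stacked p p'" ?G] by blast
  qed
  ultimately show "map_prod place_outer place_outer ` (F \<union> diagram (comp_part k p p')) \<subseteq> conn ?G"
    by auto
  fix v assume "v \<in> vertices k"
  then consider i where "i \<in> {1..k}" "v = Upper i" | i where "i \<in> {1..k}" "v = Middle i"
    | i where "i \<in> {1..k}" "v = Lower i"
    by (auto simp: vertices_def)
  then show "\<exists>a\<in>points k. (place_outer a, v) \<in> conn ?G"
  proof cases
    case (1 i)
    then show ?thesis by (intro bexI[of _ "Top i"]) (auto simp: points_def conn_refl)
  next
    case (2 i)
    then show ?thesis using up_mid by (intro bexI[of _ "Top i"]) (auto simp: points_def)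
  next
    case (3 i)
    then show ?thesis by (intro bexI[of _ "Bot i"]) (auto simp: points_def conn_refl)
  qed
qed

lemma nc_id_part: "nc (id_part k) = k"
proof -
  have "inj_on (\<lambda>i. {Top i, Bot i}) {1..k}" by (auto simp: inj_on_def doubleton_eq_iff)
  then show ?thesis by (simp add: nc_def id_part_def card_image)
qed

theorem theorem3p3:
  fixes k :: nat and p p' :: "point set set"
  assumes "p \<in> Partitions k" and "p' \<in> Partitions k"
  shows "dist_part k (id_part k) (comp_part k p p')
    \<le> dist_part k (id_part k) p + dist_part k (id_part k) p'
      - (real k + real (nc (comp_part k p p')) - real (nc p) - real (nc p')) / 2
      - real (kappa k p p')"
proof -
  let ?F = "diagram (id_part k)" and ?S = "stacked p p'"
  let ?V = "vertices k" and ?A = "points k"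
  let ?SB = "?S \<union> map_prod place_below place_below ` ?F"
  let ?SBA = "?SB \<union> map_prod place_above place_above ` ?F"
  have part: "partition_on ?A p" "partition_on ?A p'" "partition_on ?A (id_part k)"
      "partition_on ?A (comp_part k p p')"
    using assms id_part_in_Partitions comp_part_in_Partitions by (auto simp: Partitions_def)
  have join: "nc (join ?A (id_part k) q) = card (components ?A (diagram q \<union> ?F))"
    if "partition_on ?A q" for q
    using join_eq_components[OF part(3) that] by (simp add: nc_def Un_commute)
  have F: "?F \<subseteq> ?A \<times> ?A" using part(3) by (rule diagram_subset)
  have finF: "finite ?F" using F by (rule finite_subset) (simp add: finite_points)
  have below: "place_below ` ?A \<subseteq> ?V" and above: "place_above ` ?A \<subseteq> ?V"
    by (auto simp: points_def vertices_def)
  \<comment> \<open>The image of \<open>?F\<close> under \<open>place_below\<close> supplies the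
    middle--lower edges; the image of \<open>diagram p\<close> already lies in
    \<open>?S\<close>.\<close>
  have "card (components ?V ?S) + nc (join ?A (id_part k) p) \<le> nc p + card (components ?V ?SB)"
    using components_submodular[OF finite_points finite_vertices below finF F, of "diagram p" ?S]
    by (simp add: stacked_def components_diagram part join nc_def[symmetric])
  \<comment> \<open>The upper--middle edges are added to \<open>?SB\<close> rather than
    \<open>?S\<close>, so that the two bounds chain.\<close>
  moreover have "card (components ?V ?SB) + nc (join ?A (id_part k) p')
      \<le> nc p' + card (components ?V ?SBA)"
    using components_submodular[OF finite_points finite_vertices above finF F, of "diagram p'" ?SB]
    by (simp add: stacked_def components_diagram part join nc_def[symmetric] le_supI1)
  moreover have "card (components ?V ?SBA) \<le> nc (join ?A (id_part k) (comp_part k p p'))"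
    using card_components_closure_le by (simp add: join part Un_commute[of "diagram _" ?F])
  ultimately have "nc (comp_part k p p') + kappa k p p' + nc (join ?A (id_part k) p)
        + nc (join ?A (id_part k) p')
      \<le> nc p + nc p' + nc (join ?A (id_part k) (comp_part k p p'))"
    by (simp add: card_components_stacked)
  then have "real (nc (comp_part k p p')) + real (kappa k p p') + real (nc (join ?A (id_part k) p))
        + real (nc (join ?A (id_part k) p'))
      \<le> real (nc p) + real (nc p') + real (nc (join ?A (id_part k) (comp_part k p p')))"
    by linarith
  \<comment> \<open>With \<open>nc (id_part k) = k\<close>, the terms in \<open>k\<close> cancel and
    the halves of the block counts combine into whole ones.\<close>
  then show ?thesis
    unfolding dist_part_def nc_id_part by (simp add: field_simps)
qed

end
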